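(* The following two identities hold: \[ \sum_{n=0}^\infty \frac{9n^3-27n^2-14n-2}{2^n}\sum_{k=0}^n\binom{-1/3}{k}\binom{-2/3}{n-k}\binom{-1/6}{k}\binom{-5/6}{n-k}=-\frac{3\sqrt6}{8\pi}, \] \[ \sum_{n=0}^\infty \frac{18n^3-54n^2-25n-5}{2^n}\sum_{k=0}^n\binom{-1/3}{k}\binom{-2/3}{n-k}\binom{-1/6}{k}\binom{-5/6}{n-k}=\frac{3\sqrt6}{4\pi}. \]
   Context: For a complex number $x$ and an integer $k\ge 0$, the generalized binomial coefficient is $\binom{x}{k}=\frac{x(x-1)\cdots(x-k+1)}{k!}$ (with $\binom{x}{0}=1$). *)

theory Defs
  imports "HOL-Analysis.Analysis"
begin

definition inner_sum :: "nat \<Rightarrow> real" where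
  "inner_sum n = (\<Sum>k=0..n.
     ((- 1 / 3) gchoose k) * ((- 2 / 3) gchoose (n - k)) *
     ((- 1 / 6) gchoose k) * ((- 5 / 6) gchoose (n - k)))"

end

theory Submission
  imports Defs
begin

text \<open>
  The double series at \<open>z\<close> is the product of \<open>F(1/3,1/6;1;z)\<close> and \<open>F(2/3,5/6;1;z)\<close>. With
  \<open>z = 4x(1-x)\<close> both factors reduce to \<open>y(x) = F(1/3,2/3;1;x)\<close> by quadratic transformations, and
  the hypergeometric equations turn the two sums at \<open>z = 1/2\<close> into multiples of one quadratic
  form in \<open>y\<close> and \<open>y'\<close> at \<open>x = (2 - sqrt 2)/4\<close>. There \<open>x\<close> and \<open>1 - x\<close> are related by the
  modular equation of degree 2 in Ramanujan's cubic theory, so the Legendre relation between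
  \<open>y(x)\<close> and \<open>y(1-x)\<close> evaluates that form; its constant \<open>1/(\<Gamma>(1/3) \<Gamma>(2/3))\<close> gives \<open>1/\<pi>\<close>. All
  transformations follow from one principle: a solution of \<open>(P u')' = Q u\<close> regular at a zero of
  \<open>P\<close> is determined by its value there, since the Wronskian vanishes.
\<close>

section \<open>Power series and the operator \<open>x d/dx\<close>\<close>

text \<open>Each application of \<open>x d/dx\<close> multiplies the coefficient by \<open>n\<close>
  and keeps the radius of convergence, which gives the induction on \<open>j\<close>.\<close>

lemma summable_power_mult_powser:
  fixes c :: "nat \<Rightarrow> real"
  assumes "\<And>x. \<bar>x\<bar> < 1 \<Longrightarrow> summable (\<lambda>n. c n * x ^ n)" and "\<bar>x\<bar> < 1"
  shows "summable (\<lambda>n. real n ^ j * c n * x ^ n)"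
  using assms(2)
proof (induction j arbitrary: x)
  case 0
  then show ?case using assms(1) by simp
next
  case (Suc j)
  let ?d = "\<lambda>n. real n ^ j * c n"
  have "summable (\<lambda>n. diffs ?d n * x ^ n)"
    by (rule termdiff_converges[where K = 1]) (use Suc in auto)
  then have "summable (\<lambda>n. x * (diffs ?d n * x ^ n))"
    by (rule summable_mult)
  then have "summable (\<lambda>n. real (Suc n) ^ Suc j * c (Suc n) * x ^ Suc n)"
    by (simp add: diffs_def algebra_simps del: of_nat_Suc)
  then show ?case
    by (subst summable_Suc_iff[symmetric])
qed

text \<open>An Abelian theorem that reads boundary behaviour at 1 off the coefficients. Subtracting
  \<open>L / (1 - x)\<close>, the series of the constant \<open>L\<close>, leaves a bounded head and
  a tail of size at most \<open>e / 2 / (1 - x)\<close>; the factor \<open>1 - x\<close> then makes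
  the head vanish in the limit.\<close>

lemma Abel_mean_limit:
  fixes d :: "nat \<Rightarrow> real"
  assumes lim: "d \<longlonglongrightarrow> L" and sm: "\<And>x. \<bar>x\<bar> < 1 \<Longrightarrow> summable (\<lambda>n. d n * x ^ n)"
  shows "((\<lambda>x. (1 - x) * (\<Sum>n. d n * x ^ n)) \<longlongrightarrow> L) (at_left 1)"
proof (rule tendstoI)
  fix e :: real assume e: "e > 0"
  obtain N where N: "\<And>n. n \<ge> N \<Longrightarrow> \<bar>d n - L\<bar> < e / 2"
    using LIMSEQ_D[OF lim, of "e / 2"] e by auto
  define B where "B = (\<Sum>n<N. \<bar>d n - L\<bar>)"
  have "B \<ge> 0" unfolding B_def by (simp add: sum_nonneg)
  have "((\<lambda>x. (1 - x) * B) \<longlongrightarrow> (1 - 1) * B) (at_left 1)"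
    by (intro tendsto_intros)
  then have "\<forall>\<^sub>F x in at_left 1. (1 - x) * B < e / 2"
    by (rule order_tendstoD) (use e in auto)
  moreover have "\<forall>\<^sub>F x in at_left (1::real). x \<in> {0<..<1}"
    by (rule eventually_at_leftI[of 0]) auto
  ultimately show "\<forall>\<^sub>F x in at_left 1. dist ((1 - x) * (\<Sum>n. d n * x ^ n)) L < e"
  proof eventually_elim
    case (elim x)
    then have x: "0 < x" "x < 1" by auto
    have geo: "(\<lambda>n. x ^ n) sums (1 / (1 - x))"
      using x by (intro geometric_sums) auto
    have s1: "(\<lambda>n. (d n - L) * x ^ n) sums ((\<Sum>n. d n * x ^ n) - L * (1 / (1 - x)))"
      unfolding left_diff_distrib
      by (intro sums_diff summable_sums sm sums_mult geo) (use x in auto)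
    \<comment> \<open>Majorant for the terms of \<open>s1\<close>: the first \<open>N\<close> are
      bounded by \<open>\<bar>d n - L\<bar>\<close>, all later ones by
      \<open>e / 2 * x ^ n\<close>.\<close>
    have s2: "(\<lambda>n. (if n < N then \<bar>d n - L\<bar> else 0) + e / 2 * x ^ n) sums (B + e / 2 * (1 / (1 - x)))"
      unfolding B_def
      using sums_If_finite_set[of "{..<N}" "\<lambda>n. \<bar>d n - L\<bar>"]
      by (intro sums_add sums_mult geo) auto
    have "norm ((d n - L) * x ^ n) \<le> (if n < N then \<bar>d n - L\<bar> else 0) + e / 2 * x ^ n" for n
    proof (cases "n < N")
      case True
      have "\<bar>d n - L\<bar> * x ^ n \<le> \<bar>d n - L\<bar> * 1"
        using x by (intro mult_left_mono) (auto simp: power_le_one)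
      moreover have "0 \<le> e / 2 * x ^ n" using x e by auto
      ultimately show ?thesis using True x by (simp add: abs_mult)
    next
      case False
      then have "\<bar>d n - L\<bar> * x ^ n \<le> e / 2 * x ^ n"
        using x N[of n] by (intro mult_right_mono) auto
      then show ?thesis using False x by (simp add: abs_mult)
    qed
    then have "\<bar>(\<Sum>n. d n * x ^ n) - L * (1 / (1 - x))\<bar> \<le> B + e / 2 * (1 / (1 - x))"
      using norm_suminf_le[of "\<lambda>n. (d n - L) * x ^ n"
          "\<lambda>n. (if n < N then \<bar>d n - L\<bar> else 0) + e / 2 * x ^ n"] s1 s2
      by (simp add: sums_iff)
    then have "(1 - x) * \<bar>(\<Sum>n. d n * x ^ n) - L * (1 / (1 - x))\<bar> \<le> (1 - x) * (B + e / 2 * (1 / (1 - x)))"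
      using x by (intro mult_left_mono) auto
    also have "\<dots> = (1 - x) * B + e / 2" using x by (simp add: field_simps)
    also have "\<dots> < e" using elim by simp
    also have "(1 - x) * \<bar>(\<Sum>n. d n * x ^ n) - L * (1 / (1 - x))\<bar>
        = \<bar>(1 - x) * ((\<Sum>n. d n * x ^ n) - L * (1 / (1 - x)))\<bar>"
      using x by (simp add: abs_mult)
    also have "(1 - x) * ((\<Sum>n. d n * x ^ n) - L * (1 / (1 - x))) = (1 - x) * (\<Sum>n. d n * x ^ n) - L"
      using x by (simp add: field_simps)
    finally show ?case by (simp add: dist_real_def)
  qed
qed

section \<open>Regular solutions of \<open>(P u')' = Q u\<close>\<close>

text \<open>The second-order equation is written as a first-order system for \<open>u\<close> and
  its quasi-derivative \<open>uq\<close>, which stands for \<open>P u'\<close>. Derivatives are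
  taken only on the open interval, so \<open>P\<close> may vanish at 0; continuity carries the
  initial values inward. The Wronskian \<open>vq * u - uq * v\<close> is constant and zero at 0,
  hence \<open>v / u\<close> is constant too.\<close>

lemma regular_solution_unique:
  fixes u v uq vq P Q :: "real \<Rightarrow> real"
  assumes u: "\<And>x. 0 < x \<Longrightarrow> x < r \<Longrightarrow> (u has_real_derivative uq x / P x) (at x)"
    and v: "\<And>x. 0 < x \<Longrightarrow> x < r \<Longrightarrow> (v has_real_derivative vq x / P x) (at x)"
    and uq: "\<And>x. 0 < x \<Longrightarrow> x < r \<Longrightarrow> (uq has_real_derivative Q x * u x) (at x)"
    and vq: "\<And>x. 0 < x \<Longrightarrow> x < r \<Longrightarrow> (vq has_real_derivative Q x * v x) (at x)"
    and cont: "continuous_on {0..<r} u" "continuous_on {0..<r} v"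
      "continuous_on {0..<r} uq" "continuous_on {0..<r} vq"
    and init: "uq 0 = 0" "vq 0 = 0" "u 0 = v 0"
    and pos: "\<And>x. 0 \<le> x \<Longrightarrow> x < r \<Longrightarrow> u x > 0"
    and x: "0 < x" "x < r"
  shows "v x = u x" and "vq x = uq x"
proof -
  have cont': "continuous_on {0..t} f" if "continuous_on {0..<r} f" "t < r" for f :: "real \<Rightarrow> real" and t
    by (rule continuous_on_subset[OF that(1)]) (use that(2) in auto)
  have W: "vq t * u t - uq t * v t = 0" if t: "0 < t" "t < r" for t
  proof -
    have "vq t * u t - uq t * v t = vq 0 * u 0 - uq 0 * v 0"
    proof (rule DERIV_isconst_end[OF t(1)])
      show "continuous_on {0..t} (\<lambda>t. vq t * u t - uq t * v t)"
        using cont'[OF _ t(2)] cont by (intro continuous_intros) auto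
      fix s assume s: "0 < s" "s < t"
      then have s': "s < r" using t by simp
      show "((\<lambda>t. vq t * u t - uq t * v t) has_real_derivative 0) (at s)"
        by (rule derivative_eq_intros u[OF s(1) s'] v[OF s(1) s'] uq[OF s(1) s'] vq[OF s(1) s'] refl)+
           (simp add: field_simps)
    qed
    then show ?thesis using init by simp
  qed
  have "v x / u x = v 0 / u 0"
  proof (rule DERIV_isconst_end[OF x(1)])
    show "continuous_on {0..x} (\<lambda>x. v x / u x)"
      using cont'[OF _ x(2)] cont pos x by (intro continuous_intros) (auto, force)
    fix s assume s: "0 < s" "s < x"
    then have s': "s < r" using x by simp
    have "u s \<noteq> 0" using pos[of s] s s' by auto
    moreover have "vq s / P s * u s - v s * (uq s / P s) = 0"
      using W[OF s(1) s'] by (simp add: diff_divide_distrib[symmetric] mult.commute)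
    ultimately show "((\<lambda>x. v x / u x) has_real_derivative 0) (at s)"
      by (auto intro!: derivative_eq_intros u[OF s(1) s'] v[OF s(1) s'])
  qed
  moreover have "u 0 > 0" "u x > 0" using pos[of 0] pos[of x] x by auto
  ultimately show *: "v x = u x" using init(3) by simp
  show "vq x = uq x" using W[OF x] * \<open>u x > 0\<close> by simp
qed

section \<open>The hypergeometric functions with lower parameter 1\<close>

text \<open>The Taylor coefficients of \<open>F(a,b;1;x)\<close>; one of the two factors
  \<open>fact n\<close> is the Pochhammer symbol of the lower parameter 1.\<close>

definition hyp_coeff :: "real \<Rightarrow> real \<Rightarrow> nat \<Rightarrow> real" where
  "hyp_coeff a b n = pochhammer a n * pochhammer b n / (fact n)\<^sup>2"

text \<open>\<open>hyp a b j\<close> is \<open>(x d/dx)^j\<close> applied to \<open>F(a,b;1;x)\<close>.\<close>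

definition hyp :: "real \<Rightarrow> real \<Rightarrow> nat \<Rightarrow> real \<Rightarrow> real" where
  "hyp a b j x = (\<Sum>n. real n ^ j * hyp_coeff a b n * x ^ n)"

lemma hyp_coeff_0 [simp]: "hyp_coeff a b 0 = 1"
  by (simp add: hyp_coeff_def)

lemma hyp_coeff_Suc: "(real (Suc n))\<^sup>2 * hyp_coeff a b (Suc n) = (a + real n) * (b + real n) * hyp_coeff a b n"
  by (simp add: hyp_coeff_def pochhammer_Suc power_mult_distrib del: of_nat_Suc)

text \<open>These bounds put the coefficients between 0 and 1, which yields convergence for
  \<open>\<bar>x\<bar> < 1\<close> by comparison with the geometric series and positivity on
  \<open>[0,1)\<close>.\<close>

locale hyp_params =
  fixes a b :: real
  assumes a: "0 < a" "a < 1" and b: "0 < b" "b < 1"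
begin

lemma hyp_coeff_nonneg: "0 \<le> hyp_coeff a b n"
  using a b by (simp add: hyp_coeff_def pochhammer_nonneg)

lemma pochhammer_le_fact: "0 < c \<Longrightarrow> c < 1 \<Longrightarrow> pochhammer c n \<le> fact n" for c :: real
proof (induction n)
  case (Suc n)
  then have "pochhammer c n * (c + real n) \<le> fact n * (1 + real n)"
    by (intro mult_mono) (auto simp: pochhammer_nonneg)
  then show ?case by (simp add: pochhammer_Suc algebra_simps)
qed simp

lemma hyp_coeff_le_1: "hyp_coeff a b n \<le> 1"
proof -
  have "pochhammer a n * pochhammer b n \<le> fact n * fact n"
    using a b by (intro mult_mono pochhammer_le_fact) (auto simp: pochhammer_nonneg)
  then show ?thesis by (simp add: hyp_coeff_def power2_eq_square)
qed

lemma summable_hyp_coeff: "\<bar>x\<bar> < 1 \<Longrightarrow> summable (\<lambda>n. hyp_coeff a b n * x ^ n)"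
proof (rule summable_comparison_test')
  show "norm (hyp_coeff a b n * x ^ n) \<le> \<bar>x\<bar> ^ n" for n
    using mult_right_mono[OF hyp_coeff_le_1, of "\<bar>x\<bar> ^ n"] hyp_coeff_nonneg
    by (simp add: abs_mult power_abs)
qed (simp add: summable_geometric)

lemma summable_hyp: "\<bar>x\<bar> < 1 \<Longrightarrow> summable (\<lambda>n. real n ^ j * hyp_coeff a b n * x ^ n)"
  by (rule summable_power_mult_powser[OF summable_hyp_coeff])

lemma summable_norm_hyp: "\<bar>x\<bar> < 1 \<Longrightarrow> summable (\<lambda>n. norm (real n ^ j * hyp_coeff a b n * x ^ n))"
  using summable_hyp[of "\<bar>x\<bar>" j] hyp_coeff_nonneg by (simp add: abs_mult power_abs)

lemma hyp_has_derivative_diffs: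
  assumes "\<bar>x\<bar> < 1"
  shows "(hyp a b j has_real_derivative (\<Sum>n. diffs (\<lambda>n. real n ^ j * hyp_coeff a b n) n * x ^ n)) (at x)"
  unfolding hyp_def[abs_def]
  by (rule termdiffs_strong'[where K = 1]) (use assms summable_hyp in auto)

text \<open>The multiplied form avoids dividing by \<open>x\<close>, so it also covers
  \<open>x = 0\<close>.\<close>

lemma suminf_diffs_hyp:
  assumes "\<bar>x\<bar> < 1"
  shows "x * (\<Sum>n. diffs (\<lambda>n. real n ^ j * hyp_coeff a b n) n * x ^ n) = hyp a b (Suc j) x"
proof -
  let ?d = "\<lambda>n. real n ^ j * hyp_coeff a b n"
  have "summable (\<lambda>n. diffs ?d n * x ^ n)"
    by (rule termdiff_converges[where K = 1]) (use assms summable_hyp in auto)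
  from sums_mult[OF diffs_equiv[OF this], of x]
  have "(\<lambda>n. x * (real n * ?d n * x ^ (n - Suc 0))) sums (x * (\<Sum>n. diffs ?d n * x ^ n))" .
  moreover have "x * (real n * ?d n * x ^ (n - Suc 0)) = real n ^ Suc j * hyp_coeff a b n * x ^ n" for n
    by (cases n) (simp_all add: algebra_simps)
  ultimately show ?thesis by (simp add: hyp_def sums_iff)
qed

lemma hyp_deriv:
  assumes "0 < x" "x < 1"
  shows "(hyp a b j has_real_derivative hyp a b (Suc j) x / x) (at x)"
proof (rule DERIV_cong[OF hyp_has_derivative_diffs])
  show "(\<Sum>n. diffs (\<lambda>n. real n ^ j * hyp_coeff a b n) n * x ^ n) = hyp a b (Suc j) x / x"
    using suminf_diffs_hyp[of x j] assms by (simp add: nonzero_eq_divide_eq mult.commute)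
qed (use assms in auto)

lemma isCont_hyp: "\<bar>x\<bar> < 1 \<Longrightarrow> isCont (hyp a b j) x"
  by (rule DERIV_isCont[OF hyp_has_derivative_diffs])

lemma continuous_on_hyp [continuous_intros]:
  assumes "continuous_on S g" "\<And>x. x \<in> S \<Longrightarrow> \<bar>g x\<bar> < 1"
  shows "continuous_on S (\<lambda>x. hyp a b j (g x))"
proof (rule continuous_on_compose2[OF _ assms(1)])
  show "continuous_on {-1<..<1} (hyp a b j)"
    by (intro continuous_at_imp_continuous_on ballI isCont_hyp) auto
qed (use assms(2) in \<open>force simp: abs_less_iff\<close>)

lemma hyp_0 [simp]: "hyp a b 0 0 = 1" "hyp a b (Suc j) 0 = 0"
proof -
  show "hyp a b 0 0 = 1"
    using powser_zero[of "hyp_coeff a b"] by (simp add: hyp_def)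
  show "hyp a b (Suc j) 0 = 0"
    using suminf_diffs_hyp[of 0 j] by simp
qed

lemma hyp_pos: "0 \<le> x \<Longrightarrow> x < 1 \<Longrightarrow> hyp a b 0 x > 0"
proof -
  assume x: "0 \<le> x" "x < 1"
  have "(\<Sum>n<1. real n ^ 0 * hyp_coeff a b n * x ^ n) \<le> hyp a b 0 x"
    unfolding hyp_def using x hyp_coeff_nonneg
    by (intro sum_le_suminf summable_hyp) auto
  then show ?thesis by simp
qed

text \<open>With \<open>T = x d/dx\<close> the first equation is
  \<open>T^2 F = x (T + a) (T + b) F\<close>, and the second is \<open>T\<close> applied to the
  first. Both are the coefficient recurrence \<open>hyp_coeff_Suc\<close>, multiplied by a power of
  \<open>Suc n\<close> and summed.\<close>

lemma hyp_ode:
  assumes "\<bar>x\<bar> < 1"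
  shows "hyp a b 2 x = x * (hyp a b 2 x + (a + b) * hyp a b 1 x + a * b * hyp a b 0 x)"
    and "hyp a b 3 x = x * (hyp a b 2 x + (a + b) * hyp a b 1 x + a * b * hyp a b 0 x)
      + x * (hyp a b 3 x + (a + b) * hyp a b 2 x + a * b * hyp a b 1 x)"
proof -
  let ?c = "hyp_coeff a b"
  have sums: "(\<lambda>n. real n ^ j * ?c n * x ^ n) sums hyp a b j x" for j
    unfolding hyp_def by (rule summable_sums[OF summable_hyp[OF assms]])
  \<comment> \<open>For \<open>j > 0\<close> the term at index 0 vanishes, so dropping it does not
    change the sum.\<close>
  have shift: "(\<lambda>n. real (Suc n) ^ j * ?c (Suc n) * x ^ Suc n) sums hyp a b j x" if "j > 0" for j
    using sums_Suc_iff[of "\<lambda>n. real n ^ j * ?c n * x ^ n" "hyp a b j x"] sums[of j] that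
    by (simp add: power_0_left)
  have step: "real (Suc n) ^ Suc (Suc j) * ?c (Suc n) * x ^ Suc n =
     real (Suc n) ^ j * x * ((a + real n) * (b + real n) * ?c n) * x ^ n" for n j
    unfolding hyp_coeff_Suc[symmetric] by (simp add: power2_eq_square mult_ac del: of_nat_Suc)
  have "(\<lambda>n. x * (real n ^ 2 * ?c n * x ^ n + (a + b) * (real n ^ 1 * ?c n * x ^ n)
      + a * b * (real n ^ 0 * ?c n * x ^ n)))
     sums (x * (hyp a b 2 x + (a + b) * hyp a b 1 x + a * b * hyp a b 0 x))"
    by (intro sums_mult sums_add sums)
  moreover have "x * (real n ^ 2 * ?c n * x ^ n + (a + b) * (real n ^ 1 * ?c n * x ^ n)
      + a * b * (real n ^ 0 * ?c n * x ^ n)) = real (Suc n) ^ 2 * ?c (Suc n) * x ^ Suc n" for n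
    using step[of n 0] by (simp add: numeral_2_eq_2 algebra_simps)
  ultimately have "(\<lambda>n. real (Suc n) ^ 2 * ?c (Suc n) * x ^ Suc n)
     sums (x * (hyp a b 2 x + (a + b) * hyp a b 1 x + a * b * hyp a b 0 x))"
    by (simp only:)
  from sums_unique2[OF shift this]
  show "hyp a b 2 x = x * (hyp a b 2 x + (a + b) * hyp a b 1 x + a * b * hyp a b 0 x)" by simp
  have "(\<lambda>n. x * (real n ^ 2 * ?c n * x ^ n + (a + b) * (real n ^ 1 * ?c n * x ^ n)
      + a * b * (real n ^ 0 * ?c n * x ^ n)) + x * (real n ^ 3 * ?c n * x ^ n
      + (a + b) * (real n ^ 2 * ?c n * x ^ n) + a * b * (real n ^ 1 * ?c n * x ^ n)))
     sums (x * (hyp a b 2 x + (a + b) * hyp a b 1 x + a * b * hyp a b 0 x)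
      + x * (hyp a b 3 x + (a + b) * hyp a b 2 x + a * b * hyp a b 1 x))"
    by (intro sums_mult sums_add sums)
  moreover have "x * (real n ^ 2 * ?c n * x ^ n + (a + b) * (real n ^ 1 * ?c n * x ^ n)
      + a * b * (real n ^ 0 * ?c n * x ^ n)) + x * (real n ^ 3 * ?c n * x ^ n
      + (a + b) * (real n ^ 2 * ?c n * x ^ n) + a * b * (real n ^ 1 * ?c n * x ^ n))
     = real (Suc n) ^ 3 * ?c (Suc n) * x ^ Suc n" for n
    using step[of n 1] by (simp add: numeral_2_eq_2 numeral_3_eq_3 algebra_simps)
  ultimately have "(\<lambda>n. real (Suc n) ^ 3 * ?c (Suc n) * x ^ Suc n)
     sums (x * (hyp a b 2 x + (a + b) * hyp a b 1 x + a * b * hyp a b 0 x)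
      + x * (hyp a b 3 x + (a + b) * hyp a b 2 x + a * b * hyp a b 1 x))"
    by (simp only:)
  from sums_unique2[OF shift this]
  show "hyp a b 3 x = x * (hyp a b 2 x + (a + b) * hyp a b 1 x + a * b * hyp a b 0 x)
      + x * (hyp a b 3 x + (a + b) * hyp a b 2 x + a * b * hyp a b 1 x)" by simp
qed

lemma hyp_deriv_compose:
  assumes "(g has_real_derivative g') (at x)" "0 < g x" "g x < 1"
  shows "((\<lambda>x. hyp a b j (g x)) has_real_derivative hyp a b (Suc j) (g x) / g x * g') (at x)"
  using DERIV_chain2[OF hyp_deriv[OF assms(2,3)] assms(1)] .

end

interpretation cubic: hyp_params "1/3" "2/3" by unfold_locales auto
interpretation sextic1: hyp_params "1/3" "1/6" by unfold_locales auto
interpretation sextic2: hyp_params "2/3" "5/6" by unfold_locales auto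

text \<open>The factor \<open>1 - x\<close> is inserted above and below to expose the form
  \<open>uq / P\<close> with \<open>P = x (1 - x)\<close>, as \<open>regular_solution_unique\<close>
  expects.\<close>

lemma cubic_deriv:
  assumes "0 < x" "x < 1"
  shows "(hyp (1/3) (2/3) 0 has_real_derivative (1 - x) * hyp (1/3) (2/3) 1 x / (x * (1 - x))) (at x)"
  using cubic.hyp_deriv[OF assms, of 0] assms by simp

text \<open>Since \<open>1/3 + 2/3 = 1\<close>, the hypergeometric equation is self-adjoint:
  \<open>(x (1 - x) y')' = 2/9 y\<close>. The quasi-derivative \<open>x (1 - x) y'\<close> equals
  \<open>(1 - x)\<close> times \<open>x d/dx y\<close>.\<close>

lemma cubic_quasi_deriv:
  assumes "0 < x" "x < 1"
  shows "((\<lambda>x. (1 - x) * hyp (1/3) (2/3) 1 x) has_real_derivative 2/9 * hyp (1/3) (2/3) 0 x) (at x)"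
proof -
  have "(1 - x) * (hyp (1/3) (2/3) 2 x / x) - hyp (1/3) (2/3) 1 x = 2/9 * hyp (1/3) (2/3) 0 x"
    using cubic.hyp_ode(1)[of x] assms by (simp add: field_simps)
  moreover have y1: "(hyp (1/3) (2/3) 1 has_real_derivative hyp (1/3) (2/3) 2 x / x) (at x)"
    using cubic.hyp_deriv[OF assms, of 1] by (simp add: numeral_2_eq_2)
  have "((\<lambda>x. (1 - x) * hyp (1/3) (2/3) 1 x) has_real_derivative
      (1 - x) * (hyp (1/3) (2/3) 2 x / x) - hyp (1/3) (2/3) 1 x) (at x)"
    by (rule derivative_eq_intros y1 refl)+ simp
  ultimately show ?thesis
    by (simp only:)
qed

section \<open>Quadratic transformations\<close>

lemma quadratic_substitution:
  fixes x :: real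
  assumes "0 < x" "x < 1/2"
  shows "0 < 4 * x * (1 - x)" "4 * x * (1 - x) < 1"
    "((\<lambda>x. 4 * x * (1 - x)) has_real_derivative 4 * (1 - 2 * x)) (at x)"
proof -
  have "(1 - 2 * x)\<^sup>2 > 0" using assms by simp
  then show "4 * x * (1 - x) < 1" by (simp add: power2_eq_square algebra_simps)
  show "((\<lambda>x. 4 * x * (1 - x)) has_real_derivative 4 * (1 - 2 * x)) (at x)"
    by (auto intro!: derivative_eq_intros)
qed (use assms in auto)

lemma quadratic_substitution_abs:
  fixes x :: real
  assumes "x \<in> {0..<1/2}"
  shows "\<bar>4 * x * (1 - x)\<bar> < 1"
  using quadratic_substitution(1,2)[of x] assms by (cases "x = 0") auto

text \<open>As functions of \<open>x\<close>, both sides solve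
  \<open>(x (1 - x) u')' = 2/9 u\<close> and equal 1 at 0. The logarithmic derivative of
  \<open>z = 4x(1-x)\<close> is \<open>(1 - 2x) / (x (1 - x))\<close>, which explains the factor in
  the quasi-derivative.\<close>

lemma quadratic_transformation1:
  assumes "0 < x" "x < 1/2"
  shows "hyp (1/3) (1/6) 0 (4 * x * (1 - x)) = hyp (1/3) (2/3) 0 x"
    and "(1 - 2 * x) * hyp (1/3) (1/6) 1 (4 * x * (1 - x)) = (1 - x) * hyp (1/3) (2/3) 1 x"
proof -
  let ?z = "\<lambda>x::real. 4 * x * (1 - x)"
  let ?f = "\<lambda>j x. hyp (1/3) (1/6) j (?z x)"
  have d: "(?f j has_real_derivative ?f (Suc j) x / ?z x * (4 * (1 - 2 * x))) (at x)"
    if "0 < x" "x < 1/2" for x j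
    by (rule sextic1.hyp_deriv_compose) (use quadratic_substitution[OF that] in auto)
  have d0: "(?f 0 has_real_derivative (1 - 2 * x) * ?f 1 x / (x * (1 - x))) (at x)"
    if "0 < x" "x < 1/2" for x
    by (rule DERIV_cong[OF d[OF that]]) (use that in \<open>simp add: field_simps\<close>)
  have d1: "((\<lambda>x. (1 - 2 * x) * ?f 1 x) has_real_derivative 2/9 * ?f 0 x) (at x)"
    if x: "0 < x" "x < 1/2" for x
  proof -
    define z where "z = ?z x"
    have z: "0 < z" "z < 1" using quadratic_substitution[OF x] by (auto simp: z_def)
    \<comment> \<open>The square produced by differentiating is exactly the leading factor
      \<open>1 - z\<close> of the hypergeometric equation in \<open>z\<close>.\<close>
    have sq: "(1 - 2 * x) * (1 - 2 * x) = 1 - z" by (simp add: z_def algebra_simps)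
    have "(1 - z) * (?f 2 x / z) = 1/2 * ?f 1 x + 1/18 * ?f 0 x"
      using sextic1.hyp_ode(1)[of z] z unfolding z_def[symmetric] by (simp add: field_simps)
    then have "- 2 * ?f 1 x + 4 * ((1 - 2 * x) * (1 - 2 * x)) * (?f 2 x / z) = 2/9 * ?f 0 x"
      unfolding sq mult.assoc by linarith
    moreover have f1: "(?f 1 has_real_derivative ?f 2 x / z * (4 * (1 - 2 * x))) (at x)"
      using d[OF x, of 1] by (simp add: z_def numeral_2_eq_2)
    have "((\<lambda>x. (1 - 2 * x) * ?f 1 x) has_real_derivative
        - 2 * ?f 1 x + 4 * ((1 - 2 * x) * (1 - 2 * x)) * (?f 2 x / z)) (at x)"
      by (rule derivative_eq_intros f1 refl)+ simp
    ultimately show ?thesis by (simp only:)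
  qed
  note R = regular_solution_unique[where r = "1/2" and u = "hyp (1/3) (2/3) 0" and v = "?f 0"
      and uq = "\<lambda>x. (1 - x) * hyp (1/3) (2/3) 1 x" and vq = "\<lambda>x. (1 - 2 * x) * ?f 1 x"
      and P = "\<lambda>x. x * (1 - x)" and Q = "\<lambda>_. 2/9", OF cubic_deriv d0 cubic_quasi_deriv d1]
  show "?f 0 x = hyp (1/3) (2/3) 0 x"
    by (rule R) (use assms quadratic_substitution_abs cubic.hyp_pos in \<open>auto intro!: continuous_intros\<close>)
  show "(1 - 2 * x) * ?f 1 x = (1 - x) * hyp (1/3) (2/3) 1 x"
    by (rule R) (use assms quadratic_substitution_abs cubic.hyp_pos in \<open>auto intro!: continuous_intros\<close>)
qed

text \<open>The prefactor is the one in Euler's transformation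
  \<open>F(2/3,5/6;1;z) = (1-z)^(-1/2) F(1/3,1/6;1;z)\<close>, since \<open>1 - 2x\<close> is the
  square root of \<open>1 - z\<close>. The proof again goes through uniqueness; the second left-hand
  side is \<open>x (1 - x)\<close> times the derivative of the first.\<close>

lemma quadratic_transformation2:
  assumes "0 < x" "x < 1/2"
  shows "(1 - 2 * x) * hyp (2/3) (5/6) 0 (4 * x * (1 - x)) = hyp (1/3) (2/3) 0 x"
    and "(1 - 2 * x)\<^sup>2 * hyp (2/3) (5/6) 1 (4 * x * (1 - x)) - 2 * x * (1 - x) * hyp (2/3) (5/6) 0 (4 * x * (1 - x))
      = (1 - x) * hyp (1/3) (2/3) 1 x"
proof -
  let ?z = "\<lambda>x::real. 4 * x * (1 - x)"
  let ?g = "\<lambda>j x. hyp (2/3) (5/6) j (?z x)"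
  let ?w = "\<lambda>x. (1 - 2 * x)\<^sup>2 * ?g 1 x - 2 * x * (1 - x) * ?g 0 x"
  have d: "(?g j has_real_derivative ?g (Suc j) x / ?z x * (4 * (1 - 2 * x))) (at x)"
    if "0 < x" "x < 1/2" for x j
    by (rule sextic2.hyp_deriv_compose) (use quadratic_substitution[OF that] in auto)
  have d0: "((\<lambda>x. (1 - 2 * x) * ?g 0 x) has_real_derivative ?w x / (x * (1 - x))) (at x)"
    if x: "0 < x" "x < 1/2" for x
    by (rule derivative_eq_intros d[OF x] refl)+
       (use x in \<open>simp add: field_simps power2_eq_square\<close>)
  have d1: "(?w has_real_derivative 2/9 * ((1 - 2 * x) * ?g 0 x)) (at x)"
    if x: "0 < x" "x < 1/2" for x
  proof -
    define z where "z = ?z x"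
    have z: "0 < z" "z < 1" using quadratic_substitution[OF x] by (auto simp: z_def)
    have sq: "(1 - 2 * x)\<^sup>2 = 1 - z" by (simp add: z_def power2_eq_square algebra_simps)
    have "(1 - z) * (?g 2 x / z) = 3/2 * ?g 1 x + 5/9 * ?g 0 x"
      using sextic2.hyp_ode(1)[of z] z unfolding z_def[symmetric] by (simp add: field_simps)
    then have e: "(1 - z) * (?g 2 x / z * (4 * (1 - 2 * x))) =
      (3/2 * ?g 1 x + 5/9 * ?g 0 x) * (4 * (1 - 2 * x))"
      by (simp only: mult.assoc[symmetric])
    have e2: "2 * x * (1 - x) * (?g 1 x / z * (4 * (1 - 2 * x))) = 2 * (1 - 2 * x) * ?g 1 x"
      unfolding z_def using x by (simp add: field_simps)
    have w_deriv: "(?w has_real_derivative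
        (1 - 2 * x)\<^sup>2 * D1 - 4 * (1 - 2 * x) * ?g 1 x - (2 * x * (1 - x) * D0 + (2 - 4 * x) * ?g 0 x)) (at x)"
      if "(?g 1 has_real_derivative D1) (at x)" "(?g 0 has_real_derivative D0) (at x)" for D0 D1
      by (rule derivative_eq_intros that refl)+ (simp add: algebra_simps)
    have "(?w has_real_derivative
       (1 - 2 * x)\<^sup>2 * (?g 2 x / z * (4 * (1 - 2 * x))) - 4 * (1 - 2 * x) * ?g 1 x
       - (2 * x * (1 - x) * (?g 1 x / z * (4 * (1 - 2 * x))) + (2 - 4 * x) * ?g 0 x)) (at x)"
      using w_deriv[OF d[OF x, of 1] d[OF x, of 0]] by (simp only: z_def numeral_2_eq_2 One_nat_def)
    moreover have "(1 - 2 * x)\<^sup>2 * (?g 2 x / z * (4 * (1 - 2 * x))) - 4 * (1 - 2 * x) * ?g 1 x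
       - (2 * x * (1 - x) * (?g 1 x / z * (4 * (1 - 2 * x))) + (2 - 4 * x) * ?g 0 x)
      = 2/9 * ((1 - 2 * x) * ?g 0 x)"
      unfolding e2 sq e by (simp add: field_simps)
    ultimately show ?thesis by (simp only:)
  qed
  note R = regular_solution_unique[where r = "1/2" and u = "hyp (1/3) (2/3) 0" and v = "\<lambda>x. (1 - 2 * x) * ?g 0 x"
      and uq = "\<lambda>x. (1 - x) * hyp (1/3) (2/3) 1 x" and vq = ?w
      and P = "\<lambda>x. x * (1 - x)" and Q = "\<lambda>_. 2/9", OF cubic_deriv d0 cubic_quasi_deriv d1]
  show "(1 - 2 * x) * ?g 0 x = hyp (1/3) (2/3) 0 x"
    by (rule R) (use assms quadratic_substitution_abs cubic.hyp_pos in \<open>auto intro!: continuous_intros\<close>)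
  show "?w x = (1 - x) * hyp (1/3) (2/3) 1 x"
    by (rule R) (use assms quadratic_substitution_abs cubic.hyp_pos in \<open>auto intro!: continuous_intros\<close>)
qed

section \<open>The cubic modular equation of degree 2\<close>

text \<open>Together with \<open>mod2_beta\<close>, Ramanujan's rational parametrization of the
  cubic modular equation of degree 2, with multiplier \<open>1 + p\<close>.\<close>

definition mod2_alpha :: "real \<Rightarrow> real" where
  "mod2_alpha p = p * (3 + p)\<^sup>2 / (2 * (1 + p) ^ 3)"

definition mod2_beta :: "real \<Rightarrow> real" where
  "mod2_beta p = p\<^sup>2 * (3 + p) / 4"

text \<open>This is \<open>alpha (1 - alpha) / alpha'\<close>, the weight \<open>P\<close> obtained
  when the cubic equation is pulled back along \<open>mod2_alpha\<close>.\<close>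

definition mod2_P :: "real \<Rightarrow> real" where
  "mod2_P p = p * (3 + p) * (1 - p) * (2 + p) / (6 * (1 + p)\<^sup>2)"

lemma one_minus_mod2_alpha: "p \<noteq> -1 \<Longrightarrow> 1 - mod2_alpha p = (1 - p)\<^sup>2 * (2 + p) / (2 * (1 + p) ^ 3)"
proof -
  assume "p \<noteq> -1"
  then have "2 * (1 + p) ^ 3 \<noteq> 0" by (auto simp: add_eq_0_iff)
  then show ?thesis unfolding mod2_alpha_def
    by (simp add: divide_simps) (simp add: power2_eq_square power3_eq_cube algebra_simps)
qed

lemma one_minus_mod2_beta: "1 - mod2_beta p = (1 - p) * (2 + p)\<^sup>2 / 4"
  unfolding mod2_beta_def by (simp add: power2_eq_square algebra_simps)

lemma mod2_bounds:
  assumes "0 < p" "p < 1"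
  shows "0 < mod2_alpha p" "mod2_alpha p < 1" "0 < mod2_beta p" "mod2_beta p < 1"
proof -
  have "1 - mod2_alpha p > 0" "1 - mod2_beta p > 0"
    using assms by (auto simp: one_minus_mod2_alpha one_minus_mod2_beta)
  then show "mod2_alpha p < 1" "mod2_beta p < 1" by auto
qed (use assms in \<open>auto simp: mod2_alpha_def mod2_beta_def\<close>)

lemma mod2_alpha_deriv:
  assumes "0 < p"
  shows "(mod2_alpha has_real_derivative 3 * (3 + p) * (1 - p) / (2 * (1 + p) ^ 4)) (at p)"
proof -
  \<comment> \<open>The common factor left by the quotient rule, cancelled at the end to reach the
    stated form.\<close>
  have nz: "2 * (1 + p)\<^sup>2 \<noteq> 0" using assms by simp
  have "(mod2_alpha has_real_derivative
      (((3 + p)\<^sup>2 + 2 * p * (3 + p)) * (2 * (1 + p) ^ 3) - p * (3 + p)\<^sup>2 * (6 * (1 + p)\<^sup>2))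
      / ((2 * (1 + p) ^ 3) * (2 * (1 + p) ^ 3))) (at p)"
    unfolding mod2_alpha_def[abs_def]
    by (rule DERIV_divide) (use assms in \<open>auto intro!: derivative_eq_intros simp: algebra_simps power2_eq_square\<close>)
  also have "((3 + p)\<^sup>2 + 2 * p * (3 + p)) * (2 * (1 + p) ^ 3) - p * (3 + p)\<^sup>2 * (6 * (1 + p)\<^sup>2)
      = (2 * (1 + p)\<^sup>2) * (3 * (3 + p) * (1 - p))"
    by (simp add: algebra_simps power2_eq_square power3_eq_cube)
  also have "(2 * (1 + p) ^ 3) * (2 * (1 + p) ^ 3) = (2 * (1 + p)\<^sup>2) * (2 * (1 + p) ^ 4)"
    by (simp add: power2_eq_square power3_eq_cube power4_eq_xxxx)
  finally show ?thesis
    by (simp only: mult_divide_mult_cancel_left[OF nz])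
qed

lemma mod2_beta_deriv: "(mod2_beta has_real_derivative 3 * p * (2 + p) / 4) (at p)"
  unfolding mod2_beta_def[abs_def]
  by (auto intro!: derivative_eq_intros simp: algebra_simps power2_eq_square)

lemma mod2_P_deriv:
  assumes "0 < p"
  shows "(mod2_P has_real_derivative (6 - 8 * p - 12 * p\<^sup>2 - 8 * p ^ 3 - 2 * p ^ 4) / (6 * (1 + p) ^ 3)) (at p)"
proof -
  have nz: "6 * (1 + p) \<noteq> 0" using assms by simp
  have "(mod2_P has_real_derivative
      ((6 - 2 * p - 12 * p\<^sup>2 - 4 * p ^ 3) * (6 * (1 + p)\<^sup>2) - p * (3 + p) * (1 - p) * (2 + p) * (12 * (1 + p)))
      / ((6 * (1 + p)\<^sup>2) * (6 * (1 + p)\<^sup>2))) (at p)"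
    unfolding mod2_P_def[abs_def]
  proof (rule DERIV_divide)
    show "6 * (1 + p)\<^sup>2 \<noteq> 0" using assms by simp
  qed (auto intro!: derivative_eq_intros simp: algebra_simps power2_eq_square power3_eq_cube)
  also have "(6 - 2 * p - 12 * p\<^sup>2 - 4 * p ^ 3) * (6 * (1 + p)\<^sup>2) - p * (3 + p) * (1 - p) * (2 + p) * (12 * (1 + p))
      = (6 * (1 + p)) * (6 - 8 * p - 12 * p\<^sup>2 - 8 * p ^ 3 - 2 * p ^ 4)"
    by (simp add: algebra_simps power2_eq_square power3_eq_cube power4_eq_xxxx)
  also have "(6 * (1 + p)\<^sup>2) * (6 * (1 + p)\<^sup>2) = (6 * (1 + p)) * (6 * (1 + p) ^ 3)"
    by (simp add: algebra_simps power2_eq_square power3_eq_cube)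
  finally show ?thesis
    by (simp only: mult_divide_mult_cancel_left[OF nz])
qed

text \<open>In the variable \<open>p\<close>, both \<open>y(alpha)\<close> and
  \<open>(1 + p) y(beta)\<close> solve \<open>(P u')' = Q u\<close> with \<open>P = mod2_P\<close>
  and \<open>Q = 2/9 alpha'\<close>, and both equal 1 at \<open>p = 0\<close>. The second identity
  equates their quasi-derivatives.\<close>

lemma cubic_modular_degree2:
  assumes "0 < p" "p < 1"
  shows "(1 + p) * hyp (1/3) (2/3) 0 (mod2_beta p) = hyp (1/3) (2/3) 0 (mod2_alpha p)"
    and "mod2_P p * hyp (1/3) (2/3) 0 (mod2_beta p)
      + 2 / (1 + p) * ((1 - mod2_beta p) * hyp (1/3) (2/3) 1 (mod2_beta p))
      = (1 - mod2_alpha p) * hyp (1/3) (2/3) 1 (mod2_alpha p)"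
proof -
  let ?y = "hyp (1/3) (2/3) 0" and ?y1 = "hyp (1/3) (2/3) 1"
  let ?w = "\<lambda>x. (1 - x) * ?y1 x"
  let ?Q = "\<lambda>p::real. 2/9 * (3 * (3 + p) * (1 - p) / (2 * (1 + p) ^ 4))"
  let ?w2 = "\<lambda>p. mod2_P p * ?y (mod2_beta p) + 2 / (1 + p) * ?w (mod2_beta p)"
  have a0: "((\<lambda>p. ?y (mod2_alpha p)) has_real_derivative ?w (mod2_alpha p) / mod2_P p) (at p)"
    if p: "0 < p" "p < 1" for p
  proof (rule DERIV_cong[OF DERIV_chain2[OF cubic_deriv mod2_alpha_deriv]])
    have "mod2_alpha p * (1 - mod2_alpha p) = mod2_P p * (3 * (3 + p) * (1 - p) / (2 * (1 + p) ^ 4))"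
      using p by (simp add: one_minus_mod2_alpha)
        (simp add: mod2_alpha_def mod2_P_def divide_simps, simp add: algebra_simps power2_eq_square power3_eq_cube power4_eq_xxxx)
    moreover have "3 * (3 + p) * (1 - p) / (2 * (1 + p) ^ 4) \<noteq> 0" using p by auto
    moreover have "mod2_P p \<noteq> 0" using p by (simp add: mod2_P_def)
    ultimately show "?w (mod2_alpha p) / (mod2_alpha p * (1 - mod2_alpha p)) * (3 * (3 + p) * (1 - p) / (2 * (1 + p) ^ 4))
      = ?w (mod2_alpha p) / mod2_P p"
      by simp
  qed (use p mod2_bounds[OF p] in auto)
  have a1: "((\<lambda>p. ?w (mod2_alpha p)) has_real_derivative ?Q p * ?y (mod2_alpha p)) (at p)"
    if p: "0 < p" "p < 1" for p
    by (rule DERIV_cong[OF DERIV_chain2[OF cubic_quasi_deriv mod2_alpha_deriv]])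
       (use p mod2_bounds[OF p] in auto)
  \<comment> \<open>The logarithmic derivative of \<open>mod2_beta\<close>.\<close>
  have ratio: "3 * p * (2 + p) / 4 / mod2_beta p = 3 * (2 + p) / (p * (3 + p))" if p: "0 < p" "p < 1" for p
    using p by (simp add: mod2_beta_def power2_eq_square divide_simps)
  \<comment> \<open>This turns \<open>P\<close> times the logarithmic derivative of
    \<open>beta\<close> into a multiple of \<open>1 - beta\<close>, the factor in the
    quasi-derivative of \<open>y\<close> at \<open>beta\<close>.\<close>
  have P_ratio: "mod2_P p * (3 * (2 + p) / (p * (3 + p))) = 2 / (1 + p)\<^sup>2 * (1 - mod2_beta p)"
    if p: "0 < p" "p < 1" for p
    unfolding one_minus_mod2_beta using p
    by (simp add: mod2_P_def power2_eq_square divide_simps) (simp add: algebra_simps)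
  have y_beta: "((\<lambda>p. ?y (mod2_beta p)) has_real_derivative 3 * (2 + p) / (p * (3 + p)) * ?y1 (mod2_beta p)) (at p)"
    if p: "0 < p" "p < 1" for p
  proof (rule DERIV_cong[OF cubic.hyp_deriv_compose[OF mod2_beta_deriv]])
    show "hyp (1/3) (2/3) (Suc 0) (mod2_beta p) / mod2_beta p * (3 * p * (2 + p) / 4)
      = 3 * (2 + p) / (p * (3 + p)) * ?y1 (mod2_beta p)"
      unfolding ratio[OF p, symmetric] by (simp add: mult_ac)
  qed (use p mod2_bounds[OF p] in auto)
  have w_beta: "((\<lambda>p. ?w (mod2_beta p)) has_real_derivative 2/9 * ?y (mod2_beta p) * (3 * p * (2 + p) / 4)) (at p)"
    if p: "0 < p" "p < 1" for p
    by (rule DERIV_chain2[OF cubic_quasi_deriv mod2_beta_deriv]) (use p mod2_bounds[OF p] in auto)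
  have b0: "((\<lambda>p. (1 + p) * ?y (mod2_beta p)) has_real_derivative ?w2 p / mod2_P p) (at p)"
    if p: "0 < p" "p < 1" for p
  proof -
    have P: "mod2_P p \<noteq> 0" using p by (simp add: mod2_P_def)
    have "(1 + p) * (3 * (2 + p) / (p * (3 + p))) = 2 / (1 + p) * (1 - mod2_beta p) / mod2_P p"
    proof -
      have "3 * (2 + p) / (p * (3 + p)) * mod2_P p = 2 / (1 + p)\<^sup>2 * (1 - mod2_beta p)"
        using P_ratio[OF p] by (simp only: mult.commute)
      then have "3 * (2 + p) / (p * (3 + p)) = 2 / (1 + p)\<^sup>2 * (1 - mod2_beta p) / mod2_P p"
        by (rule nonzero_eq_divide_eq[OF P, THEN iffD2])
      then have "(1 + p) * (3 * (2 + p) / (p * (3 + p))) = (1 + p) * (2 / (1 + p)\<^sup>2 * (1 - mod2_beta p) / mod2_P p)"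
        by (simp only:)
      then show ?thesis using p by (simp add: power2_eq_square)
    qed
    then have eq: "?y (mod2_beta p) + (1 + p) * (3 * (2 + p) / (p * (3 + p))) * ?y1 (mod2_beta p) = ?w2 p / mod2_P p"
      using P by (simp add: add_divide_distrib)
    show ?thesis
      unfolding eq[symmetric] by (rule derivative_eq_intros y_beta[OF p] refl)+ simp
  qed
  have b1: "(?w2 has_real_derivative ?Q p * ((1 + p) * ?y (mod2_beta p))) (at p)"
    if p: "0 < p" "p < 1" for p
  proof -
    let ?P' = "(6 - 8 * p - 12 * p\<^sup>2 - 8 * p ^ 3 - 2 * p ^ 4) / (6 * (1 + p) ^ 3)"
    have inv: "((\<lambda>p. 2 / (1 + p)) has_real_derivative - (2 / (1 + p)\<^sup>2)) (at p)"
      using p by (auto intro!: derivative_eq_intros simp: power2_eq_square)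
    \<comment> \<open>The algebraic core: the coefficient of \<open>y(beta)\<close> in the
      derivative of \<open>?w2\<close> collapses to the required one, while the terms with
      \<open>?y1\<close> cancel by \<open>e1\<close> below.\<close>
    have Q: "?P' + 2 / (1 + p) * (2/9 * (3 * p * (2 + p) / 4)) = ?Q p * (1 + p)"
      using p by (simp add: divide_simps) (simp add: algebra_simps power2_eq_square power3_eq_cube power4_eq_xxxx)
    have deriv: "(?w2 has_real_derivative
        ?P' * ?y (mod2_beta p) + 3 * (2 + p) / (p * (3 + p)) * ?y1 (mod2_beta p) * mod2_P p
        + (- (2 / (1 + p)\<^sup>2) * ?w (mod2_beta p) + 2/9 * ?y (mod2_beta p) * (3 * p * (2 + p) / 4) * (2 / (1 + p)))) (at p)"
      by (intro DERIV_add DERIV_mult inv mod2_P_deriv y_beta w_beta p)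
    have e1: "3 * (2 + p) / (p * (3 + p)) * ?y1 (mod2_beta p) * mod2_P p = 2 / (1 + p)\<^sup>2 * ?w (mod2_beta p)"
      using arg_cong[OF P_ratio[OF p], of "\<lambda>t. t * ?y1 (mod2_beta p)"] by (simp only: mult_ac)
    have factor: "A * Y + 2/9 * Y * s * t = (A + t * (2/9 * s)) * Y" for A Y s t :: real
      by (simp add: algebra_simps)
    have "?P' * ?y (mod2_beta p) + 2/9 * ?y (mod2_beta p) * (3 * p * (2 + p) / 4) * (2 / (1 + p))
      = (?P' + 2 / (1 + p) * (2/9 * (3 * p * (2 + p) / 4))) * ?y (mod2_beta p)"
      by (rule factor)
    also have "\<dots> = ?Q p * ((1 + p) * ?y (mod2_beta p))"
      unfolding Q by (simp only: mult.assoc)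
    finally have e2: "?P' * ?y (mod2_beta p) + 2/9 * ?y (mod2_beta p) * (3 * p * (2 + p) / 4) * (2 / (1 + p))
      = ?Q p * ((1 + p) * ?y (mod2_beta p))" .
    have comb: "A + B + (- k * W + D) = T" if "B = k * W" "A + D = T" for A B k W D T :: real
      using that by simp
    show ?thesis
      by (rule DERIV_cong[OF deriv comb[OF e1 e2]])
  qed
  have bd: "\<bar>mod2_alpha p\<bar> < 1" "\<bar>mod2_beta p\<bar> < 1" "0 \<le> mod2_alpha p" "mod2_alpha p < 1"
    if "p \<in> {0..<1}" for p
    using mod2_bounds[of p] that by (cases "p = 0"; auto simp: mod2_alpha_def mod2_beta_def)+
  have cont: "continuous_on {0..<1} mod2_alpha" "continuous_on {0..<1} mod2_beta" "continuous_on {0..<1} mod2_P"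
    unfolding mod2_alpha_def[abs_def] mod2_beta_def[abs_def] mod2_P_def[abs_def]
    by (intro continuous_intros; force)+
  have cont2: "continuous_on {0..<1} (\<lambda>p. ?y (mod2_alpha p))" "continuous_on {0..<1} (\<lambda>p. (1 + p) * ?y (mod2_beta p))"
     "continuous_on {0..<1} (\<lambda>p. ?w (mod2_alpha p))" "continuous_on {0..<1} ?w2"
    by (intro continuous_intros cont bd; force)+
  have zero: "mod2_alpha 0 = 0" "mod2_beta 0 = 0" "mod2_P 0 = 0"
    by (simp_all add: mod2_alpha_def mod2_beta_def mod2_P_def)
  note R = regular_solution_unique[OF a0 b0 a1 b1 cont2, simplified zero]
  show "(1 + p) * ?y (mod2_beta p) = ?y (mod2_alpha p)"
    by (rule R) (use assms bd cubic.hyp_pos in auto)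
  show "?w2 p = ?w (mod2_alpha p)"
    by (rule R) (use assms bd cubic.hyp_pos in auto)
qed

section \<open>The Legendre relation\<close>

text \<open>Euler's limit for Gamma at 1/3 and 2/3: the exponents add up to 1, so the product of the
  two approximants is the inverse of \<open>n\<close> times the coefficient. The reflection formula
  evaluates \<open>Gamma (1/3) * Gamma (2/3)\<close> and brings in \<open>pi\<close>.\<close>

lemma cubic_coeff_limit: "(\<lambda>n. real n * hyp_coeff (1/3) (2/3) n) \<longlonglongrightarrow> sqrt 3 / (2 * pi)"
proof -
  have "complex_of_real (Gamma (1/3) * Gamma (2/3)) = Gamma (of_real (1/3)) * Gamma (1 - of_real (1/3))"
    by (simp add: Gamma_complex_of_real[symmetric])
  also have "\<dots> = of_real pi / sin (of_real (pi * (1/3)))"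
    using Gamma_reflection_complex[of "of_real (1/3)"] by simp
  also have "\<dots> = of_real (pi / sin (pi / 3))"
    by (simp add: sin_of_real[symmetric] del: sin_of_real)
  finally have G: "Gamma (1/3) * Gamma (2/3) = pi / (sqrt 3 / 2)"
    unfolding of_real_eq_iff sin_60 .
  have "(\<lambda>n. inverse (Gamma_series' (1/3) n * Gamma_series' (2/3) n)) \<longlonglongrightarrow> inverse (Gamma (1/3) * Gamma (2/3 :: real))"
    by (intro tendsto_intros Gamma_series'_LIMSEQ) (simp add: G)
  moreover have "\<forall>\<^sub>F n in sequentially. inverse (Gamma_series' (1/3) n * Gamma_series' (2/3) n) = real n * hyp_coeff (1/3) (2/3) n"
    using eventually_gt_at_top[of 0]
  proof eventually_elim
    case (elim n)
    then have fact_n: "fact n = real n * fact (n - 1)" by (cases n) simp_all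
    have "exp (1/3 * ln (real n)) * exp (2/3 * ln (real n)) = real n"
      using elim by (simp add: exp_add[symmetric])
    then have "Gamma_series' (1/3) n * Gamma_series' (2/3) n
      = fact (n - 1) * fact (n - 1) * real n / (pochhammer (1/3) n * pochhammer (2/3) n)"
      by (simp add: Gamma_series'_def mult_ac)
    then show ?case using elim by (simp add: hyp_coeff_def fact_n power2_eq_square field_simps)
  qed
  ultimately have "(\<lambda>n. real n * hyp_coeff (1/3) (2/3) n) \<longlonglongrightarrow> inverse (Gamma (1/3) * Gamma (2/3 :: real))"
    by (rule Lim_transform_eventually)
  then show ?thesis unfolding G by (simp add: mult.commute)
qed

text \<open>The equation is symmetric under \<open>x \<mapsto> 1 - x\<close>, so the left side is
  the constant weighted Wronskian of \<open>y(x)\<close> and \<open>y(1-x)\<close>; the plus sign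
  comes from the inner derivative -1. Its value is found by letting \<open>x\<close> tend to
  0.\<close>

lemma cubic_legendre:
  assumes x: "0 < x" "x < 1"
  shows "hyp (1/3) (2/3) 0 x * (x * hyp (1/3) (2/3) 1 (1 - x))
    + (1 - x) * hyp (1/3) (2/3) 1 x * hyp (1/3) (2/3) 0 (1 - x) = sqrt 3 / (2 * pi)"
proof -
  let ?y = "hyp (1/3) (2/3) 0" and ?y1 = "hyp (1/3) (2/3) 1" and ?c = "hyp_coeff (1/3) (2/3)"
  let ?w = "\<lambda>x. (1 - x) * ?y1 x"
  let ?E = "\<lambda>x. ?y x * ?w (1 - x) + ?w x * ?y (1 - x)"
  have refl: "((\<lambda>x. 1 - x) has_real_derivative -1) (at x)" for x :: real
    by (auto intro!: derivative_eq_intros)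
  have E': "(?E has_real_derivative 0) (at x)" if x: "0 < x" "x < 1" for x
  proof -
    have x': "0 < 1 - x" "1 - x < 1" using x by auto
    have "(?E has_real_derivative
       (1 - x) * ?y1 x / (x * (1 - x)) * ?w (1 - x) + 2/9 * ?y (1 - x) * -1 * ?y x
       + (2/9 * ?y x * ?y (1 - x)
         + (1 - (1 - x)) * ?y1 (1 - x) / ((1 - x) * (1 - (1 - x))) * -1 * ?w x)) (at x)"
      by (intro DERIV_add DERIV_mult cubic_deriv cubic_quasi_deriv x
          DERIV_chain2[OF cubic_deriv[OF x'] refl] DERIV_chain2[OF cubic_quasi_deriv[OF x'] refl])
    then show ?thesis using x by (simp add: field_simps)
  qed
  have const: "?E t = ?E x" if "t \<in> {0<..<1}" for t
    by (rule DERIV_isconst3[of 0 1]) (use that x E' in auto)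
  have flip: "filterlim (\<lambda>x::real. 1 - x) (at_left 1) (at_right 0)"
    unfolding filterlim_at
    by (auto intro!: tendsto_eq_intros eventually_at_rightI[of 0 1])
  have c0: "?c \<longlonglongrightarrow> 0"
  proof -
    have "(\<lambda>n. (real n * ?c n) * inverse (real n)) \<longlonglongrightarrow> sqrt 3 / (2 * pi) * 0"
      by (intro tendsto_mult cubic_coeff_limit lim_inverse_n)
    moreover have "\<forall>\<^sub>F n in sequentially. (real n * ?c n) * inverse (real n) = ?c n"
      using eventually_gt_at_top[of 0] by eventually_elim auto
    ultimately show ?thesis by (simp add: Lim_transform_eventually)
  qed
  \<comment> \<open>\<open>?w\<close> is itself an Abel mean, of the sequence in
    \<open>cubic_coeff_limit\<close>.\<close>
  have lim_w: "(?w \<longlongrightarrow> sqrt 3 / (2 * pi)) (at_left 1)"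
    unfolding hyp_def using Abel_mean_limit[OF cubic_coeff_limit] cubic.summable_hyp[of _ 1] by simp
  have lim_y: "((\<lambda>x. (1 - x) * ?y x) \<longlongrightarrow> 0) (at_left 1)"
    unfolding hyp_def using Abel_mean_limit[OF c0] cubic.summable_hyp[of _ 0] by simp
  \<comment> \<open>Near 0 the factor \<open>?y (1 - t)\<close> is unbounded. Writing
    \<open>?y1 t = t * D t\<close> lends it a factor \<open>t\<close>, and
    \<open>t * ?y (1 - t)\<close> tends to 0 by \<open>lim_y\<close>.\<close>
  define D where "D x = (\<Sum>n. diffs ?c n * x ^ n)" for x
  have y1D: "?y1 x = x * D x" if "\<bar>x\<bar> < 1" for x
    using cubic.suminf_diffs_hyp[OF that, of 0] by (simp add: D_def)
  have "summable (\<lambda>n. diffs ?c n * (1/2) ^ n)"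
    by (rule termdiff_converges[where K = 1]) (use cubic.summable_hyp[of _ 0] in auto)
  then have "isCont D 0"
    unfolding D_def[abs_def] by (rule isCont_powser) auto
  then have lim_D: "(D \<longlongrightarrow> D 0) (at_right 0)"
    unfolding isCont_def by (rule filterlim_at_split[THEN iffD1, THEN conjunct2])
  have lim_y0: "(?y \<longlongrightarrow> 1) (at_right 0)"
    using cubic.isCont_hyp[of 0 0] unfolding isCont_def
    by (auto simp: filterlim_at_split)
  have "((\<lambda>t. ?y t * ?w (1 - t) + (1 - t) * D t * ((1 - (1 - t)) * ?y (1 - t)))
      \<longlongrightarrow> 1 * (sqrt 3 / (2 * pi)) + (1 - 0) * D 0 * 0) (at_right 0)"
    by (intro tendsto_intros lim_y0 lim_D filterlim_compose[OF lim_w flip] filterlim_compose[OF lim_y flip])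
  moreover have "\<forall>\<^sub>F t in at_right 0. ?y t * ?w (1 - t) + (1 - t) * D t * ((1 - (1 - t)) * ?y (1 - t)) = ?E x"
  proof (rule eventually_at_rightI[of 0 1])
    fix t :: real assume t: "t \<in> {0<..<1}"
    then have "\<bar>t\<bar> < 1" by simp
    then have "?y t * ?w (1 - t) + (1 - t) * D t * ((1 - (1 - t)) * ?y (1 - t)) = ?E t"
      using y1D[of t] by (simp add: mult_ac)
    then show "?y t * ?w (1 - t) + (1 - t) * D t * ((1 - (1 - t)) * ?y (1 - t)) = ?E x"
      using const[OF t] by (simp only:)
  qed simp
  ultimately have "((\<lambda>_. ?E x) \<longlongrightarrow> sqrt 3 / (2 * pi)) (at_right (0::real))"
    by (auto intro: Lim_transform_eventually)
  then have "?E x = sqrt 3 / (2 * pi)"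
    by (simp add: tendsto_const_iff)
  then show ?thesis by simp
qed

section \<open>Evaluation at the fixed point\<close>

text \<open>For \<open>p = sqrt 2 - 1\<close> one has \<open>mod2_beta p = x\<close> and \<open>mod2_alpha p = 1 - x\<close>.\<close>

lemma cubic_fixed_point:
  defines "x \<equiv> (2 - sqrt 2) / 4"
  shows "(hyp (1/3) (2/3) 0 x)\<^sup>2 / 6 + 2 * sqrt 2 * hyp (1/3) (2/3) 0 x * ((1 - x) * hyp (1/3) (2/3) 1 x)
    = sqrt 3 / (2 * pi)"
proof -
  define p :: real where "p = sqrt 2 - 1"
  have s1: "1 < sqrt (2::real)" "sqrt 2 < (2::real)"
    by (simp, rule real_less_lsqrt) auto
  have p: "0 < p" "p < 1" using s1 by (auto simp: p_def)
  \<comment> \<open>The minimal polynomial of \<open>p\<close>, used to reduce the expressions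
    below.\<close>
  have pp: "p * p = 1 - 2 * p" by (simp add: p_def algebra_simps)
  have beta: "mod2_beta p = x"
    by (simp add: mod2_beta_def x_def power2_eq_square pp) (simp add: p_def algebra_simps)
  have "(1 + p) ^ 3 = 2 * sqrt 2" by (simp add: p_def power3_eq_cube)
  moreover have "(3 + p)\<^sup>2 = 6 + 4 * sqrt 2" by (simp add: p_def power2_eq_square algebra_simps)
  ultimately have alpha: "mod2_alpha p = 1 - x"
    by (simp add: mod2_alpha_def x_def) (simp add: p_def field_simps)
  have P: "mod2_P p = 1/6"
  proof -
    have "p * (3 + p) * (1 - p) * (2 + p) = (p * (2 + p)) * ((3 + p) * (1 - p))" by (simp add: mult_ac)
    also have "\<dots> = 2" by (simp add: algebra_simps pp)
    finally show ?thesis by (simp add: mod2_P_def) (simp add: p_def)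
  qed
  have x: "0 < x" "x < 1"
    using s1(2) less_trans[of "- sqrt 2" 0 2] by (simp_all add: x_def)
  let ?y = "hyp (1/3) (2/3) 0 x" and ?w = "(1 - x) * hyp (1/3) (2/3) 1 x"
  \<comment> \<open>The modular equation, with multiplier \<open>1 + p = sqrt 2\<close>, eliminates
    the values at \<open>1 - x\<close> from the Legendre relation.\<close>
  have 1: "hyp (1/3) (2/3) 0 (1 - x) = sqrt 2 * ?y"
    using cubic_modular_degree2(1)[OF p] unfolding alpha beta by (simp add: p_def)
  have "2 / (1 + p) = sqrt 2" by (simp add: p_def field_simps)
  then have 2: "x * hyp (1/3) (2/3) 1 (1 - x) = ?y / 6 + sqrt 2 * ?w"
    using cubic_modular_degree2(2)[OF p] unfolding alpha beta P by simp
  show ?thesis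
    using cubic_legendre[OF x] unfolding 1 2 by (simp add: power2_eq_square algebra_simps)
qed

section \<open>The double series as a Cauchy product\<close>

text \<open>Each binomial coefficient with negated upper entry is a Pochhammer quotient with sign
  \<open>(-1)^k\<close>; the signs cancel once the binomials are paired by equal lower
  index.\<close>

lemma inner_sum_hyp_coeff:
  "inner_sum n = (\<Sum>k\<le>n. hyp_coeff (1/3) (1/6) k * hyp_coeff (2/3) (5/6) (n - k))"
proof -
  have "(- c gchoose k) * (- d gchoose k) = hyp_coeff c d k" for c d :: real and k
    by (simp add: gbinomial_pochhammer hyp_coeff_def power2_eq_square flip: power_add mult_2)
  from this[of "1/3" _ "1/6"] this[of "2/3" _ "5/6"] show ?thesis
    unfolding inner_sum_def atMost_atLeast0 by (intro sum.cong) (simp_all add: mult_ac)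
qed

text \<open>The Leibniz rule for \<open>z d/dz\<close> on a product, at \<open>z = 1/2\<close>:
  \<open>n ^ m\<close> expands as \<open>(k + (n - k)) ^ m\<close>, and every resulting monomial
  gives a Cauchy product \<open>F i * G j\<close>.\<close>

lemma inner_sum_moments:
  defines "F \<equiv> \<lambda>j. hyp (1/3) (1/6) j (1/2)" and "G \<equiv> \<lambda>j. hyp (2/3) (5/6) j (1/2)"
  shows "(\<lambda>n. inner_sum n / 2 ^ n) sums (F 0 * G 0)"
    and "(\<lambda>n. real n * inner_sum n / 2 ^ n) sums (F 1 * G 0 + F 0 * G 1)"
    and "(\<lambda>n. real n ^ 2 * inner_sum n / 2 ^ n) sums (F 2 * G 0 + 2 * (F 1 * G 1) + F 0 * G 2)"
    and "(\<lambda>n. real n ^ 3 * inner_sum n / 2 ^ n) sums (F 3 * G 0 + 3 * (F 2 * G 1) + 3 * (F 1 * G 2) + F 0 * G 3)"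
proof -
  define t where "t n k = hyp_coeff (1/3) (1/6) k * hyp_coeff (2/3) (5/6) (n - k) / 2 ^ n" for n k
  have T: "(\<lambda>n. \<Sum>k\<le>n. real k ^ i * real (n - k) ^ j * t n k) sums (F i * G j)" for i j
  proof -
    have "(\<lambda>n. \<Sum>k\<le>n. (real k ^ i * hyp_coeff (1/3) (1/6) k * (1/2) ^ k)
        * (real (n - k) ^ j * hyp_coeff (2/3) (5/6) (n - k) * (1/2) ^ (n - k))) sums (F i * G j)"
      unfolding F_def G_def hyp_def
      by (rule Cauchy_product_sums[OF sextic1.summable_norm_hyp sextic2.summable_norm_hyp]) auto
    moreover have e: "(real k ^ i * hyp_coeff (1/3) (1/6) k * (1/2) ^ k)
        * (real (n - k) ^ j * hyp_coeff (2/3) (5/6) (n - k) * (1/2) ^ (n - k))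
       = real k ^ i * real (n - k) ^ j * t n k" if "k \<le> n" for n k
    proof -
      have "(1/2::real) ^ k * (1/2) ^ (n - k) = 1 / 2 ^ n"
        using that by (simp add: power_add[symmetric] power_one_over)
      moreover have "(real k ^ i * hyp_coeff (1/3) (1/6) k * (1/2) ^ k)
          * (real (n - k) ^ j * hyp_coeff (2/3) (5/6) (n - k) * (1/2) ^ (n - k))
        = real k ^ i * real (n - k) ^ j * (hyp_coeff (1/3) (1/6) k * hyp_coeff (2/3) (5/6) (n - k)
          * ((1/2) ^ k * (1/2) ^ (n - k)))"
        by (simp only: mult_ac)
      ultimately show ?thesis by (simp add: t_def)
    qed
    have "(\<Sum>k\<le>n. (real k ^ i * hyp_coeff (1/3) (1/6) k * (1/2) ^ k)
        * (real (n - k) ^ j * hyp_coeff (2/3) (5/6) (n - k) * (1/2) ^ (n - k)))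
      = (\<Sum>k\<le>n. real k ^ i * real (n - k) ^ j * t n k)" for n
      by (intro sum.cong refl e) simp
    ultimately show ?thesis by (simp only:)
  qed
  have S: "real n ^ m * inner_sum n / 2 ^ n = (\<Sum>k\<le>n. (real k + real (n - k)) ^ m * t n k)" for n m
    unfolding inner_sum_hyp_coeff t_def
    by (simp add: sum_distrib_left sum_divide_distrib)
  show "(\<lambda>n. inner_sum n / 2 ^ n) sums (F 0 * G 0)"
    using T[of 0 0] S[of _ 0] by simp
  have "real n * inner_sum n / 2 ^ n
    = (\<Sum>k\<le>n. real k ^ 1 * real (n - k) ^ 0 * t n k) + (\<Sum>k\<le>n. real k ^ 0 * real (n - k) ^ 1 * t n k)" for n
    using S[of n 1] by (simp add: sum.distrib[symmetric] algebra_simps)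
  then show "(\<lambda>n. real n * inner_sum n / 2 ^ n) sums (F 1 * G 0 + F 0 * G 1)"
    using sums_add[OF T[of 1 0] T[of 0 1]] by simp
  have "real n ^ 2 * inner_sum n / 2 ^ n
    = (\<Sum>k\<le>n. real k ^ 2 * real (n - k) ^ 0 * t n k) + 2 * (\<Sum>k\<le>n. real k ^ 1 * real (n - k) ^ 1 * t n k)
      + (\<Sum>k\<le>n. real k ^ 0 * real (n - k) ^ 2 * t n k)" for n
    unfolding S sum_distrib_left sum.distrib[symmetric]
    by (intro sum.cong refl) (simp add: power2_eq_square algebra_simps)
  then show "(\<lambda>n. real n ^ 2 * inner_sum n / 2 ^ n) sums (F 2 * G 0 + 2 * (F 1 * G 1) + F 0 * G 2)"
    using sums_add[OF sums_add[OF T[of 2 0] sums_mult[OF T[of 1 1], of 2]] T[of 0 2]] by simp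
  have "real n ^ 3 * inner_sum n / 2 ^ n
    = (\<Sum>k\<le>n. real k ^ 3 * real (n - k) ^ 0 * t n k) + 3 * (\<Sum>k\<le>n. real k ^ 2 * real (n - k) ^ 1 * t n k)
      + 3 * (\<Sum>k\<le>n. real k ^ 1 * real (n - k) ^ 2 * t n k) + (\<Sum>k\<le>n. real k ^ 0 * real (n - k) ^ 3 * t n k)" for n
    unfolding S sum_distrib_left sum.distrib[symmetric]
    by (intro sum.cong refl) (simp add: power2_eq_square power3_eq_cube algebra_simps)
  then show "(\<lambda>n. real n ^ 3 * inner_sum n / 2 ^ n)
      sums (F 3 * G 0 + 3 * (F 2 * G 1) + 3 * (F 1 * G 2) + F 0 * G 3)"
    using sums_add[OF sums_add[OF sums_add[OF T[of 3 0] sums_mult[OF T[of 2 1], of 3]] sums_mult[OF T[of 1 2], of 3]] T[of 0 3]]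
    by simp
qed

section \<open>Combination of the moments into the two identities\<close>

theorem theorem2:
  shows "(\<lambda>n::nat. (9 * real n ^ 3 - 27 * real n ^ 2 - 14 * real n - 2) / 2 ^ n * inner_sum n)
           sums (- (3 * sqrt 6) / (8 * pi))
           \<and>
         (\<lambda>n::nat. (18 * real n ^ 3 - 54 * real n ^ 2 - 25 * real n - 5) / 2 ^ n * inner_sum n)
           sums (3 * sqrt 6 / (4 * pi))"
proof -
  \<comment> \<open>The root of \<open>4x(1-x) = 1/2\<close> below 1/2, where the quadratic
    transformations apply.\<close>
  define x :: real where "x = (2 - sqrt 2) / 4"
  define y where "y = hyp (1/3) (2/3) 0 x"
  define w where "w = (1 - x) * hyp (1/3) (2/3) 1 x"
  define F where "F j = hyp (1/3) (1/6) j (1/2)" for j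
  define G where "G j = hyp (2/3) (5/6) j (1/2)" for j
  have "1 < sqrt (2::real)" "sqrt 2 < (2::real)"
    by (simp, rule real_less_lsqrt) auto
  then have x: "0 < x" "x < 1/2" by (auto simp: x_def)
  have z: "4 * x * (1 - x) = 1/2" and x2: "1 - 2 * x = sqrt 2 / 2"
    by (simp_all add: x_def algebra_simps diff_divide_distrib)
  have xx: "2 * x * (1 - x) = 1/4" using z by simp
  have cancel: "sqrt 2 * (sqrt 2 / 2 * a) = a" for a :: real
    unfolding mult.assoc[symmetric] times_divide_eq_right by simp
  have F0: "F 0 = y" and f1: "sqrt 2 / 2 * F 1 = w"
    using quadratic_transformation1[OF x] unfolding z x2 F_def y_def w_def by auto
  have F1: "F 1 = sqrt 2 * w"
    unfolding f1[symmetric] cancel ..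
  have g0: "sqrt 2 / 2 * G 0 = y"
    using quadratic_transformation2(1)[OF x] unfolding z x2 G_def y_def .
  have G0: "G 0 = sqrt 2 * y"
    unfolding g0[symmetric] cancel ..
  have G1: "G 1 = 2 * w + sqrt 2 / 2 * y"
    using quadratic_transformation2(2)[OF x] unfolding z x2 xx G0[unfolded G_def y_def] w_def[symmetric]
    unfolding G_def y_def by (simp add: power2_eq_square field_simps)
  have half: "\<bar>1/2::real\<bar> < 1" by simp
  \<comment> \<open>The hypergeometric equations at 1/2 reduce the higher values to those of index 0
    and 1, hence to \<open>y\<close> and \<open>w\<close>.\<close>
  have F2: "F 2 = F 1 / 2 + F 0 / 18"
    using sextic1.hyp_ode(1)[of "1/2"] by (simp add: F_def)
  have F3: "F 3 = 2 * F 2 + F 2 / 2 + F 1 / 18"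
    using sextic1.hyp_ode[OF half] unfolding F_def by (linarith | simp add: field_simps)
  have G2: "G 2 = 3/2 * G 1 + 5/9 * G 0"
    using sextic2.hyp_ode(1)[of "1/2"] by (simp add: G_def)
  have G3: "G 3 = 2 * G 2 + 3/2 * G 2 + 5/9 * G 1"
    using sextic2.hyp_ode[OF half] unfolding G_def by (linarith | simp add: field_simps)
  have rel: "y\<^sup>2 / 6 + 2 * sqrt 2 * y * w = sqrt 3 / (2 * pi)"
    using cubic_fixed_point unfolding y_def w_def x_def by simp
  \<comment> \<open>The extra \<open>sqrt 2\<close> comes from \<open>G 0\<close> and
    \<open>F 1\<close>, and turns \<open>sqrt 3\<close> into \<open>sqrt 6\<close>.\<close>
  have rel': "sqrt 2 * (y\<^sup>2 / 6 + 2 * sqrt 2 * y * w) = sqrt 6 / (2 * pi)"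
    unfolding rel by (simp add: real_sqrt_mult[symmetric])
  note M = inner_sum_moments[folded F_def G_def]
  have "(\<lambda>n. a * (real n ^ 3 * inner_sum n / 2 ^ n) + b * (real n ^ 2 * inner_sum n / 2 ^ n)
      + c * (real n * inner_sum n / 2 ^ n) + d * (inner_sum n / 2 ^ n))
    sums (a * (F 3 * G 0 + 3 * (F 2 * G 1) + 3 * (F 1 * G 2) + F 0 * G 3)
      + b * (F 2 * G 0 + 2 * (F 1 * G 1) + F 0 * G 2) + c * (F 1 * G 0 + F 0 * G 1) + d * (F 0 * G 0))"
    (is "_ sums ?V a b c d") for a b c d
    by (intro sums_add sums_mult M)
  note V = this
  \<comment> \<open>The terms in \<open>w * w\<close> total
    \<open>sqrt 2 * (12 * a + 4 * b)\<close>, which vanishes for \<open>b = -3 * a\<close>, as in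
    both identities. The coefficients \<open>c\<close> and \<open>d\<close> make the remaining
    \<open>y * w\<close> and \<open>y * y\<close> terms proportional to \<open>rel'\<close>.\<close>
  have *: "?V 9 (-27) (-14) (-2) = - (3 * sqrt 6) / (8 * pi)"
  proof -
    have "?V 9 (-27) (-14) (-2) = - (3/4) * (sqrt 2 * (y\<^sup>2 / 6 + 2 * sqrt 2 * y * w))"
      unfolding F3 F2 F1 F0 G3 G2 G1 G0 by (simp add: power2_eq_square algebra_simps)
    then show ?thesis unfolding rel' by simp
  qed
  have **: "?V 18 (-54) (-25) (-5) = 3 * sqrt 6 / (4 * pi)"
  proof -
    have "?V 18 (-54) (-25) (-5) = 3/2 * (sqrt 2 * (y\<^sup>2 / 6 + 2 * sqrt 2 * y * w))"
      unfolding F3 F2 F1 F0 G3 G2 G1 G0 by (simp add: power2_eq_square algebra_simps)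
    then show ?thesis unfolding rel' by simp
  qed
  have "(9 * real n ^ 3 - 27 * real n ^ 2 - 14 * real n - 2) / 2 ^ n * inner_sum n
    = 9 * (real n ^ 3 * inner_sum n / 2 ^ n) + -27 * (real n ^ 2 * inner_sum n / 2 ^ n)
      + -14 * (real n * inner_sum n / 2 ^ n) + -2 * (inner_sum n / 2 ^ n)" for n
    by (simp add: divide_inverse algebra_simps)
  moreover have "(18 * real n ^ 3 - 54 * real n ^ 2 - 25 * real n - 5) / 2 ^ n * inner_sum n
    = 18 * (real n ^ 3 * inner_sum n / 2 ^ n) + -54 * (real n ^ 2 * inner_sum n / 2 ^ n)
      + -25 * (real n * inner_sum n / 2 ^ n) + -5 * (inner_sum n / 2 ^ n)" for n
    by (simp add: divide_inverse algebra_simps)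
  ultimately show ?thesis
    using V[of 9 "-27" "-14" "-2"] V[of 18 "-54" "-25" "-5"] unfolding * **
    by (simp only:)
qed

end
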